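(* Let $a<b$ be real numbers and let $P$ be the uniform distribution on the closed interval $[a,b]$. Then for every $n\in\mathbb{N}$ the optimal set of $n$-means for $P$ is $$\alpha_n=\Big\{a+\frac{2i-1}{2n}(b-a) : 1\leq i\leq n\Big\},$$ and the corresponding $n$th quantization error is $$V_n(P)=\frac{(a-b)^2}{12n^2}.$$
   Context: The uniform distribution $P$ on $[a,b]$ is the Borel probability measure on $\mathbb{R}$ with density $f(x)=\frac{1}{b-a}$ for $x\in[a,b]$ and $f(x)=0$ otherwise. For a Borel probability measure $P$ on $\mathbb{R}^d$ (here $d=1$) with $\int\|x\|^2dP(x)<\infty$ and a nonempty finite set $\alpha\subset\mathbb{R}^d$, put $V(P;\alpha)=\int\min_{c\in\alpha}\|x-c\|^2\,dP(x)$. The $n$th quantization error is $V_n(P)=\inf\{V(P;\alpha):\alpha\subset\mathbb{R}^d,\ 1\le\operatorname{card}(\alpha)\leq n\}$. An optimal set of $n$-means for $P$ is a set $\alpha$ with at most $n$ points for which this infimum is attained. $\mathbb{N}=\{1,2,3,\dots\}$. *)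

theory Defs
  imports "HOL-Probability.Probability"
begin

definition uniform_dist :: "real \<Rightarrow> real \<Rightarrow> real measure" where
  "uniform_dist a b =
     density lborel (\<lambda>x. ennreal (if x \<in> {a..b} then 1 / (b - a) else 0))"

(* The definitions below are meant for Borel probability measures P with finite
   second moment: then the Bochner integral is the usual one, for every finite
   nonempty A.  The lemmas at the end show that uniform_dist a b is such a
   measure whenever a < b. *)

definition distortion :: "'a::euclidean_space measure \<Rightarrow> 'a set \<Rightarrow> real" where
  "distortion P A = (LINT x|P. (MIN c\<in>A. (norm (x - c))\<^sup>2))"

definition codebooks :: "nat \<Rightarrow> 'a set set" where
  "codebooks n = {A. finite A \<and> 1 \<le> card A \<and> card A \<le> n}"

definition quantization_error :: "nat \<Rightarrow> 'a::euclidean_space measure \<Rightarrow> real" where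
  "quantization_error n P = (INF A\<in>codebooks n. distortion P A)"

definition optimal_n_means :: "nat \<Rightarrow> 'a::euclidean_space measure \<Rightarrow> 'a set \<Rightarrow> bool" where
  "optimal_n_means n P A \<longleftrightarrow>
     A \<in> codebooks n \<and> distortion P A = quantization_error n P"

lemma sets_uniform_dist: "sets (uniform_dist a b) = sets borel"
  by (simp add: uniform_dist_def)

lemma prob_space_uniform_dist:
  assumes "a < b"
  shows "prob_space (uniform_dist a b)"
proof
  have "emeasure (uniform_dist a b) (space (uniform_dist a b)) =
      (\<integral>\<^sup>+x. ennreal (1 / (b - a)) * indicator {a..b} x \<partial>lborel)"
    unfolding uniform_dist_def
    by (subst emeasure_density) (auto intro!: nn_integral_cong split: split_indicator)
  also have "\<dots> = ennreal (1 / (b - a)) * ennreal (b - a)"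
    using assms by (subst nn_integral_cmult_indicator) auto
  also have "\<dots> = 1"
    using assms by (simp add: ennreal_mult[symmetric])
  finally show "emeasure (uniform_dist a b) (space (uniform_dist a b)) = 1" .
qed

lemma integrable_square_norm_uniform_dist:
  assumes "a < b"
  shows "integrable (uniform_dist a b) (\<lambda>x. (norm x)\<^sup>2)"
proof -
  have "integrable lborel (\<lambda>x. indicator {a..b} x *\<^sub>R ((1 / (b - a)) * (norm x)\<^sup>2))"
    by (intro borel_integrable_compact) (use assms in \<open>auto intro!: continuous_intros\<close>)
  then have "integrable lborel
      (\<lambda>x. (if x \<in> {a..b} then 1 / (b - a) else 0) *\<^sub>R (norm x)\<^sup>2)"
    by (rule Bochner_Integration.integrable_cong[THEN iffD1, rotated 2]) auto
  then show ?thesis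
    using assms by (auto simp: uniform_dist_def integrable_density)
qed

end

theory Submission
  imports Defs
begin

text \<open>
  Write \<open>h = (b - a) / (2 * n)\<close>, so that \<open>b = a + 2 * n * h\<close>, and let \<open>d x\<close> be the squared
  distance from \<open>x\<close> to a codebook \<open>A\<close>.  The optimal codebook should cut the interval into cells
  of half-length \<open>h\<close>, and this suggests measuring how far \<open>d\<close> falls below \<open>h\<^sup>2\<close>.  A point \<open>c\<close> of
  \<open>A\<close> can only be responsible for the deficit \<open>max 0 (h\<^sup>2 - (x - c)\<^sup>2)\<close>, so
  \<open>h\<^sup>2 - d x \<le> (\<Sum>c\<in>A. max 0 (h\<^sup>2 - (x - c)\<^sup>2))\<close>.  Each of these bumps has integral at most
  \<open>4 * h^3 / 3\<close>, and there are at most \<open>n\<close> of them.  Hence the integral of \<open>d\<close> is at least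
  \<open>h\<^sup>2 * (2 * n * h) - n * (4 * h^3 / 3) = n * (2 * h^3 / 3)\<close>, which the grid of cell midpoints
  attains (lemmas \<open>square_dist_integral_ge\<close> and \<open>midpoint_grid_integral_le\<close>).

  For uniqueness, both sides of the pointwise inequality are continuous, so equality of the
  integrals forces equality at every point of the interval.  In particular \<open>d x \<le> h\<^sup>2\<close> there: the
  at most \<open>n\<close> closed intervals of length \<open>2 * h\<close> around the points of \<open>A\<close> cover an interval of
  length \<open>2 * n * h\<close>.  Such a covering has no room for overlaps, and peeling off its leftmost
  interval shows by induction that \<open>A\<close> is the grid (lemma \<open>tight_cover_unique\<close>).
\<close>

definition square_dist :: "real set \<Rightarrow> real \<Rightarrow> real" where
  "square_dist A x = (MIN c\<in>A. (x - c)\<^sup>2)"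

definition midpoint_grid :: "real \<Rightarrow> real \<Rightarrow> nat \<Rightarrow> real set" where
  "midpoint_grid a h n = (\<lambda>i. a + (2 * real i + 1) * h) ` {..<n}"

section \<open>The squared distance to a finite set\<close>

lemma square_dist_le:
  assumes "finite A" "c \<in> A"
  shows "square_dist A x \<le> (x - c)\<^sup>2"
  using assms by (simp add: square_dist_def)

lemma square_dist_attained:
  assumes "finite A" "A \<noteq> {}"
  obtains c where "c \<in> A" "square_dist A x = (x - c)\<^sup>2"
proof -
  have "square_dist A x \<in> (\<lambda>c. (x - c)\<^sup>2) ` A"
    unfolding square_dist_def using assms by (intro Min_in) auto
  then show thesis using that by blast
qed

lemma continuous_on_square_dist:
  assumes "finite A" "A \<noteq> {}"
  shows "continuous_on S (square_dist A)"
  using assms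
proof (induction rule: finite_ne_induct)
  case (singleton c)
  then show ?case
    by (simp add: square_dist_def[abs_def] continuous_intros)
next
  case (insert c A)
  have "square_dist (insert c A) = (\<lambda>x. min ((x - c)\<^sup>2) (square_dist A x))"
    using insert.hyps by (simp add: square_dist_def[abs_def])
  then show ?case
    using insert.IH by (auto intro!: continuous_intros)
qed

lemma square_dist_integrable:
  assumes "finite A" "A \<noteq> {}"
  shows "square_dist A integrable_on {l..u}"
  using assms by (intro integrable_continuous_interval continuous_on_square_dist)

lemma distortion_uniform_dist:
  assumes "a < b" "finite A" "A \<noteq> {}"
  shows "distortion (uniform_dist a b) A = integral {a..b} (square_dist A) / (b - a)"
proof -
  have cont: "continuous_on UNIV (square_dist A)"
    using assms by (intro continuous_on_square_dist)
  then have meas: "square_dist A \<in> borel_measurable lborel"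
    by (simp add: borel_measurable_continuous_onI)
  have set_int: "set_integrable lborel {a..b} (square_dist A)"
    using cont by (intro borel_integrable_atLeastAtMost')
      (auto intro: continuous_on_subset)
  have "distortion (uniform_dist a b) A = (LINT x|uniform_dist a b. square_dist A x)"
    by (simp add: distortion_def square_dist_def)
  also have "\<dots> = (LINT x|lborel. (if x \<in> {a..b} then 1 / (b - a) else 0) *\<^sub>R square_dist A x)"
    unfolding uniform_dist_def using assms(1) meas by (intro integral_density) auto
  also have "\<dots> = (LINT x|lborel. (1 / (b - a)) * (indicator {a..b} x *\<^sub>R square_dist A x))"
    by (intro Bochner_Integration.integral_cong) (auto split: split_indicator)
  also have "\<dots> = (1 / (b - a)) * (LINT x:{a..b}|lborel. square_dist A x)"
    by (simp add: set_lebesgue_integral_def)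
  also have "\<dots> = (1 / (b - a)) * integral {a..b} (square_dist A)"
    using set_borel_integral_eq_integral(2)[OF set_int] by simp
  finally show ?thesis by simp
qed

section \<open>The lower bound\<close>

lemma has_integral_square_cell:
  fixes c h :: real
  assumes "h \<ge> 0"
  shows "((\<lambda>x. (x - c)\<^sup>2) has_integral 2 * h ^ 3 / 3) {c - h..c + h}"
proof -
  have "((\<lambda>x. (x - c)\<^sup>2) has_integral ((c + h - c) ^ 3 / 3 - (c - h - c) ^ 3 / 3)) {c - h..c + h}"
    using assms
    by (intro fundamental_theorem_of_calculus)
       (auto intro!: derivative_eq_intros
             simp flip: has_real_derivative_iff_has_vector_derivative)
  then show ?thesis by (simp add: power3_eq_cube mult.assoc)
qed

lemma bump_integral_le:
  fixes c h :: real
  assumes "h \<ge> 0"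
  shows "integral {l..u} (\<lambda>x. max 0 (h\<^sup>2 - (x - c)\<^sup>2)) \<le> 4 * h ^ 3 / 3"
proof -
  have "((\<lambda>x. h\<^sup>2 - (x - c)\<^sup>2) has_integral measure lborel {c - h..c + h} *\<^sub>R h\<^sup>2 - 2 * h ^ 3 / 3)
      {c - h..c + h}"
    using assms by (intro has_integral_diff has_integral_square_cell has_integral_const_real) auto
  then have "((\<lambda>x. h\<^sup>2 - (x - c)\<^sup>2) has_integral 4 * h ^ 3 / 3) {c - h..c + h}"
    using assms by (simp add: power2_eq_square power3_eq_cube mult.assoc)
  moreover have "max 0 (h\<^sup>2 - (x - c)\<^sup>2) = (if x \<in> {c - h..c + h} then h\<^sup>2 - (x - c)\<^sup>2 else 0)" for x
  proof -
    have "(x - c)\<^sup>2 \<le> h\<^sup>2 \<longleftrightarrow> x \<in> {c - h..c + h}"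
      using assms by (auto simp: abs_le_square_iff[symmetric])
    then show ?thesis by auto
  qed
  ultimately have whole:
      "((\<lambda>x. max 0 (h\<^sup>2 - (x - c)\<^sup>2)) has_integral 4 * h ^ 3 / 3) UNIV"
    by (simp only: has_integral_restrict_UNIV)
  have "integral {l..u} (\<lambda>x. max 0 (h\<^sup>2 - (x - c)\<^sup>2)) \<le> integral UNIV (\<lambda>x. max 0 (h\<^sup>2 - (x - c)\<^sup>2))"
    using whole
    by (intro integral_subset_le integrable_continuous_interval continuous_intros) auto
  with whole show ?thesis by (simp add: integral_unique)
qed

text \<open>The difference of the two sides of the pointwise inequality behind the lower bound.\<close>

definition excess :: "real \<Rightarrow> real set \<Rightarrow> real \<Rightarrow> real" where
  "excess h A x = square_dist A x - h\<^sup>2 + (\<Sum>c\<in>A. max 0 (h\<^sup>2 - (x - c)\<^sup>2))"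

text \<open>The bump of a point of \<open>A\<close> nearest to \<open>x\<close> already makes up for the deficit at \<open>x\<close>.\<close>

lemma excess_nonneg:
  assumes "finite A" "A \<noteq> {}"
  shows "excess h A x \<ge> 0"
proof -
  obtain c where c: "c \<in> A" "square_dist A x = (x - c)\<^sup>2"
    using square_dist_attained[OF assms] .
  have "h\<^sup>2 - (x - c)\<^sup>2 \<le> max 0 (h\<^sup>2 - (x - c)\<^sup>2)" by simp
  also have "\<dots> \<le> (\<Sum>c\<in>A. max 0 (h\<^sup>2 - (x - c)\<^sup>2))"
    using c assms by (intro member_le_sum) auto
  finally show ?thesis using c by (simp add: excess_def)
qed

lemma continuous_on_excess:
  assumes "finite A" "A \<noteq> {}"
  shows "continuous_on S (excess h A)"
  unfolding excess_def using assms
  by (intro continuous_intros continuous_on_square_dist)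

lemma integral_excess_le:
  fixes a h :: real
  assumes "h \<ge> 0" "finite A" "A \<noteq> {}" "card A \<le> n"
  shows "integral {a..a + 2 * real n * h} (excess h A)
       \<le> integral {a..a + 2 * real n * h} (square_dist A) - real n * (2 * h ^ 3 / 3)"
proof -
  let ?I = "{a..a + 2 * real n * h}"
  let ?bump = "\<lambda>c x. max 0 (h\<^sup>2 - (x - c)\<^sup>2)"
  have bump: "?bump c integrable_on ?I" for c
    by (intro integrable_continuous_interval continuous_intros)
  have "integral ?I (excess h A)
      = integral ?I (square_dist A) - 2 * real n * h * h\<^sup>2 + (\<Sum>c\<in>A. integral ?I (?bump c))"
  proof -
    have "((\<lambda>x. square_dist A x - h\<^sup>2 + (\<Sum>c\<in>A. ?bump c x)) has_integral
        integral ?I (square_dist A) - measure lborel ?I *\<^sub>R h\<^sup>2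
          + (\<Sum>c\<in>A. integral ?I (?bump c))) ?I"
      using assms bump
      by (intro has_integral_add has_integral_diff has_integral_sum has_integral_const_real
            integrable_integral square_dist_integrable) auto
    then show ?thesis
      using assms(1) by (simp add: excess_def[abs_def] integral_unique)
  qed
  moreover have "(\<Sum>c\<in>A. integral ?I (?bump c)) \<le> real (card A) * (4 * h ^ 3 / 3)"
    using assms by (intro sum_bounded_above bump_integral_le)
  moreover have "\<dots> \<le> real n * (4 * h ^ 3 / 3)"
    using assms by (intro mult_right_mono) auto
  moreover have "2 * real n * h * h\<^sup>2 = real n * (2 * h ^ 3)"
    by (simp add: power2_eq_square power3_eq_cube)
  ultimately show ?thesis by simp
qed

lemma square_dist_integral_ge:
  fixes a h :: real
  assumes "h \<ge> 0" "finite A" "A \<noteq> {}" "card A \<le> n"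
  shows "real n * (2 * h ^ 3 / 3) \<le> integral {a..a + 2 * real n * h} (square_dist A)"
proof -
  have "0 \<le> integral {a..a + 2 * real n * h} (excess h A)"
    using assms
    by (intro integral_nonneg integrable_continuous_interval continuous_on_excess excess_nonneg)
  with integral_excess_le[OF assms, of a] show ?thesis by simp
qed

section \<open>The midpoint grid attains the bound\<close>

lemma finite_midpoint_grid [simp]: "finite (midpoint_grid a h n)"
  by (simp add: midpoint_grid_def)

lemma midpoint_grid_empty_iff [simp]: "midpoint_grid a h n = {} \<longleftrightarrow> n = 0"
  by (auto simp: midpoint_grid_def)

lemma card_midpoint_grid_le: "card (midpoint_grid a h n) \<le> n"
  unfolding midpoint_grid_def using card_image_le[of "{..<n}"] by simp

lemma midpoint_grid_Suc:
  "midpoint_grid a h (Suc n) = insert (a + h) (midpoint_grid (a + 2 * h) h n)"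
  unfolding midpoint_grid_def lessThan_Suc_eq_insert_0 image_insert image_image
  by (simp add: algebra_simps)

text \<open>
  On each cell the squared distance to the grid is at most that to the midpoint of the cell.  The
  grid is kept fixed while the number of cells grows, so that the induction adds one cell at a time.
\<close>

lemma midpoint_grid_integral_le:
  fixes a h :: real
  assumes "h \<ge> 0" "k \<le> n" "n > 0"
  shows "integral {a..a + 2 * real k * h} (square_dist (midpoint_grid a h n))
       \<le> real k * (2 * h ^ 3 / 3)"
  using assms(2)
proof (induction k)
  case 0
  then show ?case by simp
next
  case (Suc k)
  let ?d = "square_dist (midpoint_grid a h n)"
  let ?m = "a + (2 * real k + 1) * h"
  have m: "?m \<in> midpoint_grid a h n"
    using Suc.prems by (auto simp: midpoint_grid_def)
  have cell: "{a + 2 * real k * h..a + 2 * real (Suc k) * h} = {?m - h..?m + h}"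
    by (simp add: algebra_simps)
  have "integral {a..a + 2 * real (Suc k) * h} ?d
      = integral {a..a + 2 * real k * h} ?d
        + integral {a + 2 * real k * h..a + 2 * real (Suc k) * h} ?d"
    using assms by (intro Henstock_Kurzweil_Integration.integral_combine[symmetric]
        square_dist_integrable) (auto intro: mult_right_mono)
  also have "integral {a + 2 * real k * h..a + 2 * real (Suc k) * h} ?d
      \<le> integral {?m - h..?m + h} (\<lambda>x. (x - ?m)\<^sup>2)"
    unfolding cell using assms m has_integral_square_cell[OF \<open>h \<ge> 0\<close>, of ?m]
    by (intro integral_le square_dist_integrable square_dist_le) auto
  also have "\<dots> = 2 * h ^ 3 / 3"
    by (rule integral_unique[OF has_integral_square_cell[OF \<open>h \<ge> 0\<close>]])
  finally show ?case
    using Suc by (simp add: algebra_simps)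
qed

section \<open>Uniqueness\<close>

text \<open>
  The leftmost centre must reach down to \<open>a\<close>, so it reaches no further than \<open>a + 2 * h\<close>, and the
  remaining centres cover the rest; by induction they form a grid whose first cell begins at
  \<open>a + 2 * h\<close>, so the leftmost centre alone covers \<open>{a<..<a + 2 * h}\<close> and is its midpoint.  With
  closed target intervals the case \<open>n = 0\<close> would ask for a covering of a point by no intervals;
  open ones make the induction start from the empty set.
\<close>

lemma tight_cover_unique:
  fixes a h :: real
  assumes "h > 0" "finite A" "card A \<le> n"
    and "\<And>x. a < x \<Longrightarrow> x < a + 2 * real n * h \<Longrightarrow> \<exists>c\<in>A. \<bar>x - c\<bar> \<le> h"
  shows "A = midpoint_grid a h n"
  using assms(2-4)
proof (induction n arbitrary: a A)
  case 0
  then show ?case by (simp add: midpoint_grid_def)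
next
  case (Suc n)
  define c0 where "c0 = Min A"
  have ne: "A \<noteq> {}"
    using Suc.prems(3)[of "a + h"] \<open>h > 0\<close> by (auto simp: algebra_simps add_pos_nonneg)
  have c0: "c0 \<in> A" "\<And>c. c \<in> A \<Longrightarrow> c0 \<le> c"
    using ne Suc.prems(1) by (auto simp: c0_def)
  have nh: "0 \<le> real n * h" using \<open>h > 0\<close> by simp
  have end_eq: "a + 2 * real (Suc n) * h = a + 2 * h + 2 * real n * h"
    by (simp add: algebra_simps)
  have "c0 - h \<le> a"
  proof (rule dense_ge_bounded)
    show "a < a + 2 * h" using \<open>h > 0\<close> by simp
  next
    fix x assume "a < x" "x < a + 2 * h"
    then obtain c where "c \<in> A" "\<bar>x - c\<bar> \<le> h"
      using Suc.prems(3)[of x] nh unfolding end_eq by auto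
    with c0(2)[of c] show "c0 - h \<le> x" by linarith
  qed
  then have left: "c0 \<le> a + h" by simp
  have rest: "A - {c0} = midpoint_grid (a + 2 * h) h n"
  proof (rule Suc.IH)
    show "finite (A - {c0})" using Suc.prems(1) by simp
    show "card (A - {c0}) \<le> n" using Suc.prems(1,2) c0(1) by simp
  next
    fix x assume x: "a + 2 * h < x" "x < a + 2 * h + 2 * real n * h"
    then obtain c where "c \<in> A" "\<bar>x - c\<bar> \<le> h"
      using Suc.prems(3)[of x] \<open>h > 0\<close> unfolding end_eq by auto
    moreover have "c \<noteq> c0" using x(1) \<open>\<bar>x - c\<bar> \<le> h\<close> left by linarith
    ultimately show "\<exists>c\<in>A - {c0}. \<bar>x - c\<bar> \<le> h" by blast
  qed
  have right_of: "a + 3 * h \<le> c" if "c \<in> A" "c \<noteq> c0" for c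
  proof -
    have "c \<in> midpoint_grid (a + 2 * h) h n" using that rest by blast
    then show ?thesis using \<open>h > 0\<close> by (auto simp: midpoint_grid_def algebra_simps)
  qed
  have "a + 2 * h \<le> c0 + h"
  proof (rule dense_le_bounded)
    show "a < a + 2 * h" using \<open>h > 0\<close> by simp
  next
    fix x assume x: "a < x" "x < a + 2 * h"
    then obtain c where c: "c \<in> A" "\<bar>x - c\<bar> \<le> h"
      using Suc.prems(3)[of x] nh unfolding end_eq by auto
    then have "c = c0" using right_of[of c] x(2) by linarith
    with c show "x \<le> c0 + h" by linarith
  qed
  with left have "c0 = a + h" by simp
  with c0(1) rest show ?case by (auto simp: midpoint_grid_Suc)
qed

lemma square_dist_integral_minimal_unique:
  fixes a h :: real
  assumes "h > 0" "finite A" "A \<noteq> {}" "card A \<le> n"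
    and minimal: "integral {a..a + 2 * real n * h} (square_dist A) \<le> real n * (2 * h ^ 3 / 3)"
  shows "A = midpoint_grid a h n"
proof (rule tight_cover_unique)
  let ?I = "{a..a + 2 * real n * h}"
  have cont: "continuous_on ?I (excess h A)"
    using assms by (intro continuous_on_excess)
  have "integral ?I (excess h A) \<le> 0"
    using integral_excess_le[of h A n a] assms by simp
  moreover have "0 \<le> integral ?I (excess h A)"
    using assms cont by (intro integral_nonneg integrable_continuous_interval excess_nonneg)
  moreover have "n > 0"
    using assms by (cases n) auto
  then have "a < a + 2 * real n * h"
    using \<open>h > 0\<close> by simp
  ultimately have zero: "\<forall>x\<in>?I. excess h A x = 0"
    using integral_eq_0_iff[OF cont] excess_nonneg[OF assms(2,3)] by auto
  fix x assume x: "a < x" "x < a + 2 * real n * h"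
  obtain c where c: "c \<in> A" "square_dist A x = (x - c)\<^sup>2"
    using square_dist_attained[OF assms(2,3)] .
  have "0 \<le> (\<Sum>c\<in>A. max 0 (h\<^sup>2 - (x - c)\<^sup>2))" by (intro sum_nonneg) auto
  moreover have "excess h A x = 0" using zero x by simp
  ultimately have "square_dist A x \<le> h\<^sup>2" unfolding excess_def by linarith
  with c \<open>h > 0\<close> have "\<bar>x - c\<bar> \<le> h" by (simp add: abs_le_square_iff[symmetric])
  with c show "\<exists>c\<in>A. \<bar>x - c\<bar> \<le> h" by blast
qed (use assms in auto)

section \<open>Optimal codebooks of the uniform distribution\<close>

theorem theorem2p1p1:
  fixes a b :: real and n :: nat
  assumes "a < b" and "n \<ge> 1"
  shows "(\<forall>\<alpha>. optimal_n_means n (uniform_dist a b) \<alpha> \<longleftrightarrow>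
            \<alpha> = {a + (2 * real i - 1) / (2 * real n) * (b - a) | i :: nat. 1 \<le> i \<and> i \<le> n})
       \<and> quantization_error n (uniform_dist a b) = (a - b)\<^sup>2 / (12 * (real n)\<^sup>2)"
proof -
  define h where "h = (b - a) / (2 * real n)"
  define V where "V = (a - b)\<^sup>2 / (12 * (real n)\<^sup>2)"
  let ?P = "uniform_dist a b"
  let ?G = "midpoint_grid a h n"
  have n: "real n > 0" using assms by simp
  have h: "h > 0" using assms by (simp add: h_def)
  have b: "b = a + 2 * real n * h" using n by (simp add: h_def)
  have V: "V = real n * (2 * h ^ 3 / 3) / (b - a)"
    using n h by (simp add: V_def b power2_eq_square power3_eq_cube)
  have code: "finite A \<and> A \<noteq> {} \<and> card A \<le> n" if "A \<in> codebooks n" for A :: "real set"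
    using that by (auto simp: codebooks_def)
  have dist: "distortion ?P A = integral {a..a + 2 * real n * h} (square_dist A) / (b - a)"
    if "A \<in> codebooks n" for A
    using distortion_uniform_dist[OF \<open>a < b\<close>, of A] code[OF that] b by simp
  have lower: "V \<le> distortion ?P A" if "A \<in> codebooks n" for A
    unfolding V dist[OF that] using \<open>a < b\<close> h code[OF that]
    by (intro divide_right_mono square_dist_integral_ge) auto
  have unique: "A = ?G" if "A \<in> codebooks n" "distortion ?P A \<le> V" for A
  proof (rule square_dist_integral_minimal_unique[OF h])
    show "integral {a..a + 2 * real n * h} (square_dist A) \<le> real n * (2 * h ^ 3 / 3)"
      using that(2) \<open>a < b\<close> unfolding V dist[OF that(1)] divide_le_cancel by simp
  qed (use code[OF that(1)] in auto)
  have G: "?G \<in> codebooks n"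
    using assms card_midpoint_grid_le[of a h n]
    by (auto simp: codebooks_def Suc_le_eq card_gt_0_iff)
  have "distortion ?P ?G \<le> V"
    unfolding V dist[OF G] using \<open>a < b\<close> h assms
    by (intro divide_right_mono midpoint_grid_integral_le) auto
  with lower[OF G] have GV: "distortion ?P ?G = V" by simp
  have error: "quantization_error n ?P = V"
    unfolding quantization_error_def
    using G GV lower by (intro cInf_eq_minimum) (auto simp: image_iff)
  have grid: "?G = {a + (2 * real i - 1) / (2 * real n) * (b - a) | i :: nat. 1 \<le> i \<and> i \<le> n}"
  proof -
    have "?G = (\<lambda>i. a + (2 * real i - 1) * h) ` Suc ` {..<n}"
      by (simp add: midpoint_grid_def image_image algebra_simps)
    also have "Suc ` {..<n} = {1..n}"
      by (simp add: lessThan_atLeast0 image_Suc_atLeastLessThan atLeastLessThanSuc_atLeastAtMost)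
    finally show ?thesis by (auto simp: h_def)
  qed
  have "optimal_n_means n ?P A \<longleftrightarrow> A = ?G" for A
  proof
    assume "optimal_n_means n ?P A"
    then show "A = ?G" by (intro unique) (simp_all add: optimal_n_means_def error)
  next
    assume "A = ?G"
    then show "optimal_n_means n ?P A" by (simp add: optimal_n_means_def error G GV)
  qed
  with error show ?thesis by (simp add: grid V_def)
qed

end
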